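(* For every real number $\kappa<1/\sqrt{\pi}$ there exist a map $T:C\to C$ on the unit cube $C=[0,1]^{\mathbb N}\subseteq \ell^\infty(\mathbb N)$ which is nonexpansive for the norm $\|\cdot\|_\infty$ (that is, $\|Tx-Ty\|_\infty\le\|x-y\|_\infty$ for all $x,y\in C$), an initial point $x^0\in C$, and a constant sequence $\alpha_n\equiv\alpha$ with $\alpha\in\,]0,1[$, such that the Krasnosel'skii–Mann iterates $$x^{n+1}=(1-\alpha_{n+1})\,x^n+\alpha_{n+1}\,Tx^n,\qquad n\ge 0,$$ satisfy for some integer $n\ge 1$ $$\|x^n-Tx^n\|_\infty>\kappa\,\frac{\operatorname{diam}(C)}{\sqrt{\sum_{i=1}^n\alpha_i(1-\alpha_i)}} .$$ (Equivalently, the constant $\kappa=1/\sqrt{\pi}$ cannot be replaced by a smaller one in the bound $\|x^n-Tx^n\|\le \kappa\operatorname{diam}(C)/\sqrt{\sum_{i=1}^n\alpha_i(1-\alpha_i)}$ for Krasnosel'skii–Mann iterates of nonexpansive maps.)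
   Context: $\ell^\infty(\mathbb N)$ is the space of bounded real sequences with the supremum norm $\|\cdot\|_\infty$; $[0,1]^{\mathbb N}$ is the set of sequences with all entries in $[0,1]$. The diameter $\operatorname{diam}(C)=\sup_{x,y\in C}\|x-y\|_\infty$ is taken in this norm (so $\operatorname{diam}(C)=1$ here). *)

theory Defs
  imports "HOL-Analysis.Analysis"
begin

text \<open>
  The topology of \<^typ>\<open>nat\<close> is discrete, so every bounded real sequence is a bounded continuous
  function and the normed space of bounded continuous functions from \<^typ>\<open>nat\<close> to \<^typ>\<open>real\<close> is
  exactly the space of bounded sequences with the supremum norm; the next two facts confirm this.
\<close>

type_synonym linf = "nat \<Rightarrow>\<^sub>C real"

lemma range_apply_linf: "range (apply_bcontfun :: linf \<Rightarrow> nat \<Rightarrow> real) = {f. bounded (range f)}"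
  by (auto simp: type_definition.Rep_range[OF type_definition_bcontfun] bcontfun_def)

lemma norm_linf: "norm (x :: linf) = (SUP i. \<bar>apply_bcontfun x i\<bar>)"
  by (simp add: norm_bcontfun_def dist_bcontfun_def zero_bcontfun.rep_eq)

definition unit_cube :: "linf set" where
  "unit_cube = {x. \<forall>i. apply_bcontfun x i \<in> {0..1}}"

definition nonexpansive_on :: "'a::real_normed_vector set \<Rightarrow> ('a \<Rightarrow> 'a) \<Rightarrow> bool" where
  "nonexpansive_on C T \<longleftrightarrow> (\<forall>x\<in>C. \<forall>y\<in>C. norm (T x - T y) \<le> norm (x - y))"

text \<open>Krasnosel'skii--Mann iterates; the value of the step sequence at 0 is never used.\<close>

primrec km_iterate ::
  "('a::real_normed_vector \<Rightarrow> 'a) \<Rightarrow> (nat \<Rightarrow> real) \<Rightarrow> 'a \<Rightarrow> nat \<Rightarrow> 'a" where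
  "km_iterate T \<alpha> x0 0 = x0"
| "km_iterate T \<alpha> x0 (Suc n) =
     (1 - \<alpha> (Suc n)) *\<^sub>R km_iterate T \<alpha> x0 n + \<alpha> (Suc n) *\<^sub>R T (km_iterate T \<alpha> x0 n)"

end

theory Submission
  imports Defs "HOL-Real_Asymp.Real_Asymp"
begin

text \<open>
  Take a constant step \<^term>\<open>1 - \<epsilon>\<close>. The iterates are averages of the points
  \<open>w\<^sub>0 = x\<^sup>0\<close>, \<open>w\<^sub>i = T x\<^sup>i\<^sup>-\<^sup>1\<close>. For \<open>m < n\<close> one coordinate of the sequence space is reserved, in
  which the \<open>w\<^sub>i\<close> are given by an (almost) optimal dual potential of the transport problem between
  the weights of \<open>x\<^sup>m\<close> and \<open>x\<^sup>n\<close>, with cost \<open>\<parallel>w\<^sub>i - w\<^sub>j\<parallel>\<close>. Then \<open>\<parallel>x\<^sup>n - x\<^sup>m\<parallel>\<close> is at least the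
  transport distance, while \<open>\<parallel>w\<^bsub>n+1\<^esub> - w\<^bsub>m+1\<^esub>\<parallel>\<close> is at most a recursively defined
  lower bound for it, so that \<open>x\<^sup>i \<mapsto> w\<^bsub>i+1\<^esub>\<close> is nonexpansive and extends to the cube
  coordinatewise. Up to terms of order \<open>\<epsilon>\<^sup>2\<close> the recursion is the one of a lazy symmetric random
  walk in \<open>n - m\<close> that survives until it hits 0; started at 1, its survival probability is
  governed by central binomial coefficients, hence by Wallis' product, and behaves like
  \<open>1 / sqrt (pi * \<epsilon> * n)\<close> when \<open>\<epsilon> \<rightarrow> 0\<close>, \<open>\<epsilon> * n \<rightarrow> \<infinity>\<close> and \<open>\<epsilon>\<^sup>2 * n \<rightarrow> 0\<close>.
\<close>

section \<open>Potentials of a concave distance profile\<close>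

text \<open>Monotonicity and subadditivity make \<open>g (j - i)\<close>, for
  \<open>i \<le> j\<close>, a pseudometric on time points. Concavity is the stronger condition that
  the mixed case of \<open>pot_diff_le\<close> calls for.\<close>

locale concave_profile =
  fixes g :: "nat \<Rightarrow> real"
  assumes zero: "g 0 = 0"
    and mono: "a \<le> b \<Longrightarrow> g a \<le> g b"
    and concave: "a \<le> b \<Longrightarrow> g (b + s) - g b \<le> g (a + s) - g a"
begin

text \<open>
  A Kantorovich potential for the inside-out transport between the averaging weights at times
  \<^term>\<open>m < n\<close>. Beyond the time horizon \<^term>\<open>n\<close> it only has to stay Lipschitz; lowering it by
  \<^term>\<open>\<eta>\<close> there compensates the mass lost by killing.
\<close>

definition pot :: "real \<Rightarrow> nat \<Rightarrow> nat \<Rightarrow> nat \<Rightarrow> real" where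
  "pot \<eta> m n i =
     (if n < i then max 0 (g n - \<eta>)
      else if i < m then g n - g (n - i)
      else g (i - m) + g n - g (n - m))"

lemma nonneg: "0 \<le> g a"
  using mono[of 0 a] zero by simp

lemma subadditive: "g (a + b) \<le> g a + g b"
  using concave[of 0 a b] zero by simp

lemma pot_0: "m < n \<Longrightarrow> pot \<eta> m n 0 = 0"
  by (simp add: pot_def zero)

lemma pot_end: "m < n \<Longrightarrow> pot \<eta> m n n = g n"
  by (simp add: pot_def)

lemma pot_mono:
  assumes "m < n" "i \<le> j" "j \<le> n"
  shows "pot \<eta> m n i \<le> pot \<eta> m n j"
proof -
  have "g (n - m) \<le> g (n - i)" if "i < m"
    using that by (intro mono) auto
  moreover have "g (n - j) \<le> g (n - i)" "g (i - m) \<le> g (j - m)"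
    using assms by (auto intro!: mono)
  ultimately show ?thesis
    using assms nonneg[of "j - m"] by (auto simp: pot_def)
qed

text \<open>For \<open>i\<close> and \<open>j\<close> on the same side of \<open>m\<close> this is
  subadditivity. For \<open>i < m \<le> j\<close> it says that the increment of \<open>g\<close>
  over a length \<open>m - i\<close> is no larger at \<open>n - m\<close> than at
  \<open>j - m\<close>.\<close>

lemma pot_diff_le:
  assumes "m < n" "i \<le> j" "j \<le> n"
  shows "pot \<eta> m n j - pot \<eta> m n i \<le> g (j - i)"
proof -
  have "g (n - i) \<le> g (n - j) + g (j - i)"
    using subadditive[of "n - j" "j - i"] assms by simp
  moreover have "g (n - i) - g (n - m) \<le> g (j - i) - g (j - m)" if "i < m" "m \<le> j"
    using concave[of "j - m" "n - m" "m - i"] that assms by simp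
  moreover have "g (j - m) \<le> g (i - m) + g (j - i)" if "m \<le> i"
    using subadditive[of "i - m" "j - i"] that assms by simp
  ultimately show ?thesis
    using assms by (auto simp: pot_def)
qed

lemma pot_range:
  assumes "m < n" "0 \<le> \<eta>"
  shows "pot \<eta> m n i \<in> {0..g n}"
proof (cases "i \<le> n")
  case True
  then show ?thesis
    using pot_mono[of m n 0 i \<eta>] pot_mono[of m n i n \<eta>] assms by (simp add: pot_0 pot_end)
qed (use assms nonneg[of n] in \<open>simp add: pot_def\<close>)

end

section \<open>The killed lazy random walk\<close>

definition step :: "real \<Rightarrow> real \<Rightarrow> (int \<Rightarrow> real) \<Rightarrow> int \<Rightarrow> real" where
  "step c p f D = c * f D + p * (f (D + 1) + f (D - 1))"

lemma step_funpow_odd: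
  assumes "\<And>D. f (- D) = - f D"
  shows "(step c p ^^ t) f (- D) = - (step c p ^^ t) f D"
proof (induction t arbitrary: D)
  case (Suc t)
  define h where "h = (step c p ^^ t) f"
  have "h (- D + 1) = - h (D - 1)" "h (- D - 1) = - h (D + 1)" "h (- D) = - h D"
    using Suc[of "D - 1"] Suc[of "D + 1"] Suc[of D] by (simp_all add: h_def algebra_simps)
  then have "step c p h (- D) = - step c p h D"
    by (simp add: step_def algebra_simps)
  then show ?case
    by (simp add: h_def)
qed (simp add: assms)

text \<open>
  With \<^term>\<open>\<epsilon> = 1 - \<alpha>\<close>, this is the probability that a lazy walk started at \<^term>\<open>D \<ge> 1\<close>
  has neither hit 0 nor been killed (at rate \<^term>\<open>\<epsilon>\<^sup>2\<close>) up to time \<^term>\<open>t\<close>. Starting from the odd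
  function \<^const>\<open>sgn\<close> on all integers replaces the absorbing boundary at 0 by a reflection.
\<close>

definition surv :: "real \<Rightarrow> nat \<Rightarrow> int \<Rightarrow> real" where
  "surv \<epsilon> t = (step ((1 - \<epsilon>)\<^sup>2) (\<epsilon> * (1 - \<epsilon>)) ^^ t) (\<lambda>D. of_int (sgn D))"

lemma surv_0 [simp]: "surv \<epsilon> 0 D = of_int (sgn D)"
  by (simp add: surv_def)

lemma surv_Suc:
  "surv \<epsilon> (Suc t) D =
    (1 - \<epsilon>)\<^sup>2 * surv \<epsilon> t D + \<epsilon> * (1 - \<epsilon>) * (surv \<epsilon> t (D + 1) + surv \<epsilon> t (D - 1))"
  by (simp add: surv_def step_def)

lemma surv_minus: "surv \<epsilon> t (- D) = - surv \<epsilon> t D"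
  unfolding surv_def by (rule step_funpow_odd) simp

lemma surv_zero [simp]: "surv \<epsilon> t 0 = 0"
  using surv_minus[of \<epsilon> t 0] by simp

text \<open>The profile \<open>surv \<epsilon> (n - 1)\<close> is the distance allowed between the
  points numbered \<open>n - k\<close> and \<open>n\<close>. \<open>M\<close> is the last index in
  play, so the drop \<open>M * \<epsilon>\<^sup>2\<close> covers the killing during all steps beyond
  \<open>n\<close>.\<close>

definition potential :: "real \<Rightarrow> nat \<Rightarrow> nat \<Rightarrow> nat \<Rightarrow> nat \<Rightarrow> real" where
  "potential \<epsilon> M m n = concave_profile.pot (\<lambda>k. surv \<epsilon> (n - 1) (int k)) (real M * \<epsilon>\<^sup>2) m n"

context
  fixes \<epsilon> :: real
  assumes eps: "0 < \<epsilon>" "\<epsilon> < 1"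
begin

lemma surv_mono: "D \<le> D' \<Longrightarrow> surv \<epsilon> t D \<le> surv \<epsilon> t D'"
proof (induction t arbitrary: D D')
  case 0
  then show ?case by (auto simp: sgn_if)
next
  case (Suc t)
  show ?case unfolding surv_Suc
    using eps Suc.prems by (intro add_mono mult_left_mono Suc.IH) auto
qed

lemma surv_nonneg: "0 \<le> D \<Longrightarrow> 0 \<le> surv \<epsilon> t D"
  using surv_mono[of 0 D t] by simp

lemma kernel_mass: "(1 - \<epsilon>)\<^sup>2 + \<epsilon> * (1 - \<epsilon>) * 2 = 1 - \<epsilon>\<^sup>2"
  by (simp add: power2_eq_square algebra_simps)

text \<open>A walk started beyond \<open>t\<close> cannot reach 0 within \<open>t\<close> steps, so
  only killing counts.\<close>

lemma surv_far: "int t < D \<Longrightarrow> surv \<epsilon> t D = (1 - \<epsilon>\<^sup>2) ^ t"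
proof (induction t arbitrary: D)
  case (Suc t)
  then show ?case
    by (simp add: surv_Suc flip: kernel_mass) (simp add: algebra_simps)
qed simp

lemma eps_sq: "0 \<le> \<epsilon>\<^sup>2" "\<epsilon>\<^sup>2 \<le> 1"
  using eps by (auto simp: power_le_one)

lemma surv_le_one: "surv \<epsilon> t D \<le> 1"
proof -
  have "surv \<epsilon> t D \<le> surv \<epsilon> t (max D (int t + 1))"
    by (rule surv_mono) simp
  also have "\<dots> = (1 - \<epsilon>\<^sup>2) ^ t"
    by (rule surv_far) simp
  also have "\<dots> \<le> 1"
    using eps_sq by (simp add: power_le_one)
  finally show ?thesis .
qed

text \<open>Concavity on the half line passes through a step because \<open>surv\<close> is odd: the
  increments at -1 and 0 agree, so increments are non-increasing already from -1 on, as far left as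
  a step from \<open>D \<ge> 0\<close> looks.\<close>

lemma surv_increment_antimono:
  "0 \<le> D \<Longrightarrow> surv \<epsilon> t (D + 2) - surv \<epsilon> t (D + 1) \<le> surv \<epsilon> t (D + 1) - surv \<epsilon> t D"
proof (induction t arbitrary: D)
  case 0
  then show ?case by (auto simp: sgn_if)
next
  case (Suc t)
  define h where "h D = surv \<epsilon> t (D + 1) - surv \<epsilon> t D" for D
  have h: "h (D + 1) \<le> h D" if "- 1 \<le> D" for D
  proof (cases "D = - 1")
    case True
    then show ?thesis
      by (simp add: h_def surv_minus)
  next
    case False
    then show ?thesis
      using Suc.IH[of D] that by (simp add: h_def add.assoc)
  qed
  have hS: "surv \<epsilon> (Suc t) (D + 1) - surv \<epsilon> (Suc t) D =
      (1 - \<epsilon>)\<^sup>2 * h D + \<epsilon> * (1 - \<epsilon>) * (h (D + 1) + h (D - 1))" for D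
    by (simp add: surv_Suc h_def algebra_simps)
  have "h (D + 1) \<le> h D" "h (D + 2) + h D \<le> h (D + 1) + h (D - 1)"
    using h[of D] h[of "D + 1"] h[of "D - 1"] Suc.prems by (auto simp: add.commute)
  then have "(1 - \<epsilon>)\<^sup>2 * h (D + 1) + \<epsilon> * (1 - \<epsilon>) * (h (D + 2) + h D)
      \<le> (1 - \<epsilon>)\<^sup>2 * h D + \<epsilon> * (1 - \<epsilon>) * (h (D + 1) + h (D - 1))"
    using eps by (intro add_mono[OF mult_left_mono mult_left_mono]) auto
  then show ?case
    using hS[of D] hS[of "D + 1"] by (simp add: add.commute)
qed

lemma surv_concave:
  assumes "0 \<le> a" "a \<le> b" "0 \<le> s"
  shows "surv \<epsilon> t (b + s) - surv \<epsilon> t b \<le> surv \<epsilon> t (a + s) - surv \<epsilon> t a"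
proof -
  define h where "h D = surv \<epsilon> t (D + 1) - surv \<epsilon> t D" for D
  have h: "h y \<le> h x" if "x \<le> y" "0 \<le> x" for x y
    using that
  proof (induction y rule: int_ge_induct)
    case (step y)
    then show ?case
      using surv_increment_antimono[of y t] by (simp add: h_def add.commute)
  qed simp
  show ?thesis
    using \<open>0 \<le> s\<close>
  proof (induction s rule: int_ge_induct)
    case (step s)
    then show ?case
      using h[of "a + s" "b + s"] assms by (simp add: h_def add.assoc)
  qed simp
qed

text \<open>By concavity the mean over the two neighbours is at most the value at \<open>D\<close>;
  killing only lowers it further.\<close>

lemma surv_Suc_le:
  assumes "0 \<le> D"
  shows "surv \<epsilon> (Suc t) D \<le> surv \<epsilon> t D"
proof (cases "D = 0")
  case False
  then have "surv \<epsilon> t (D + 1) + surv \<epsilon> t (D - 1) \<le> 2 * surv \<epsilon> t D"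
    using surv_increment_antimono[of "D - 1" t] assms by (simp add: add.commute)
  then have "surv \<epsilon> (Suc t) D \<le> (1 - \<epsilon>)\<^sup>2 * surv \<epsilon> t D + \<epsilon> * (1 - \<epsilon>) * (2 * surv \<epsilon> t D)"
    unfolding surv_Suc using eps by (intro add_mono mult_left_mono) auto
  also have "\<dots> = (1 - \<epsilon>\<^sup>2) * surv \<epsilon> t D"
    by (simp flip: kernel_mass add: algebra_simps)
  also have "\<dots> \<le> 1 * surv \<epsilon> t D"
    using surv_nonneg[OF assms] by (intro mult_right_mono) auto
  finally show ?thesis by simp
qed simp

lemma surv_antimono: "s \<le> t \<Longrightarrow> 0 \<le> D \<Longrightarrow> surv \<epsilon> t D \<le> surv \<epsilon> s D"
  by (induction t rule: dec_induct) (auto intro: order_trans[OF surv_Suc_le])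

text \<open>Start one unit further right and run one step longer: after the first step the walk is
  still at \<open>D\<close> or beyond, so only the killed mass, at most
  \<open>\<epsilon>\<^sup>2\<close>, is lost.\<close>

lemma surv_shift:
  assumes "0 \<le> D"
  shows "surv \<epsilon> t D - real r * \<epsilon>\<^sup>2 \<le> surv \<epsilon> (t + r) (D + int r)"
proof (induction r)
  case (Suc r)
  let ?u = "surv \<epsilon> (t + r)" and ?E = "D + int r"
  have nn: "0 \<le> ?E" using assms by simp
  have "(1 - \<epsilon>\<^sup>2) * ?u ?E = (1 - \<epsilon>)\<^sup>2 * ?u ?E + \<epsilon> * (1 - \<epsilon>) * (?u ?E + ?u ?E)"
    by (simp flip: kernel_mass add: algebra_simps)
  also have "\<dots> \<le> (1 - \<epsilon>)\<^sup>2 * ?u (?E + 1) + \<epsilon> * (1 - \<epsilon>) * (?u (?E + 1 + 1) + ?u (?E + 1 - 1))"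
    using eps surv_mono[of ?E "?E + 1" "t + r"] surv_mono[of ?E "?E + 1 + 1" "t + r"]
    by (intro add_mono mult_left_mono) auto
  also have "\<dots> = surv \<epsilon> (Suc (t + r)) (?E + 1)"
    by (simp only: surv_Suc)
  finally have "?u ?E - \<epsilon>\<^sup>2 * ?u ?E \<le> surv \<epsilon> (Suc (t + r)) (?E + 1)"
    by (simp add: algebra_simps)
  moreover have "\<epsilon>\<^sup>2 * ?u ?E \<le> \<epsilon>\<^sup>2"
    using surv_le_one[of "t + r" ?E] by (simp add: mult_left_le)
  ultimately show ?case
    using Suc by (simp add: algebra_simps)
qed simp


section \<open>Range and Lipschitz bounds of the potentials\<close>

lemma concave_profile_surv: "concave_profile (\<lambda>k. surv \<epsilon> t (int k))"
  by unfold_locales (auto intro: surv_mono surv_concave)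

lemma potential_range:
  assumes "m < n"
  shows "potential \<epsilon> M m n i \<in> {0..1}"
  using concave_profile.pot_range[OF concave_profile_surv assms, of "real M * \<epsilon>\<^sup>2" "n - 1" i]
    surv_le_one[of "n - 1" "int n"] by (auto simp: potential_def)

text \<open>Up to the horizon \<open>n\<close> this is \<open>pot_diff_le\<close>, since
  \<open>surv\<close> decreases in time. Only a pair straddling \<open>n\<close> needs the drop
  \<open>\<eta>\<close>, which has to be large enough for one sign of the difference and small
  enough for the other.\<close>

lemma potential_lipschitz:
  assumes "m < n" "i < j" "j \<le> M" and slack: "real M * \<epsilon>\<^sup>2 \<le> surv \<epsilon> M 1"
  shows "\<bar>potential \<epsilon> M m n i - potential \<epsilon> M m n j\<bar> \<le> surv \<epsilon> (j - 1) (int (j - i))"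
proof -
  define \<eta> where "\<eta> = real M * \<epsilon>\<^sup>2"
  interpret concave_profile "\<lambda>k. surv \<epsilon> (n - 1) (int k)"
    by (rule concave_profile_surv)
  have "\<bar>pot \<eta> m n i - pot \<eta> m n j\<bar> \<le> surv \<epsilon> (j - 1) (int (j - i))"
  proof -
    consider "j \<le> n" | "i \<le> n" "n < j" | "n < i"
      by linarith
    then show ?thesis
    proof cases
      case 1
      have "\<bar>pot \<eta> m n i - pot \<eta> m n j\<bar> = pot \<eta> m n j - pot \<eta> m n i"
        using pot_mono[of m n i j \<eta>] assms 1 by simp
      also have "\<dots> \<le> surv \<epsilon> (n - 1) (int (j - i))"
        using assms 1 by (intro pot_diff_le) auto
      also have "\<dots> \<le> surv \<epsilon> (j - 1) (int (j - i))"
        using 1 by (intro surv_antimono) auto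
      finally show ?thesis .
    next
      case 2
      have pj: "pot \<eta> m n j = max 0 (pot \<eta> m n n - \<eta>)"
        using 2 assms by (simp add: pot_def[of \<eta> m n j] pot_end del: One_nat_def)
      have "pot \<eta> m n 0 \<le> pot \<eta> m n i"
        using assms 2 by (intro pot_mono) auto
      then have pi: "0 \<le> pot \<eta> m n i"
        using assms pot_0[of m n \<eta>] by simp
      have pi': "pot \<eta> m n i \<le> pot \<eta> m n n"
        using assms 2 by (intro pot_mono) auto
      \<comment> \<open>The drop outweighs the loss in \<open>surv_shift\<close> over the
        \<open>j - n\<close> steps past the horizon.\<close>
      have "real (j - n) * \<epsilon>\<^sup>2 \<le> \<eta>"
        unfolding \<eta>_def using assms by (intro mult_right_mono) auto
      moreover have "pot \<eta> m n n - pot \<eta> m n i \<le> surv \<epsilon> (n - 1) (int (n - i))"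
        using assms 2 by (intro pot_diff_le) auto
      moreover have "surv \<epsilon> (n - 1) (int (n - i)) - real (j - n) * \<epsilon>\<^sup>2
          \<le> surv \<epsilon> (j - 1) (int (j - i))"
      proof -
        have "(n - 1) + (j - n) = j - 1" "int (n - i) + int (j - n) = int (j - i)"
          using assms 2 by simp_all
        then show ?thesis
          using surv_shift[of "int (n - i)" "n - 1" "j - n"] by (simp only: of_nat_0_le_iff)
      qed
      ultimately have up: "pot \<eta> m n n - pot \<eta> m n i - \<eta> \<le> surv \<epsilon> (j - 1) (int (j - i))"
        by linarith
      \<comment> \<open>In the other direction the difference can be as large as
        \<open>\<eta>\<close>; \<open>slack\<close> keeps this below the smallest distance that
        occurs.\<close>
      have "\<eta> \<le> surv \<epsilon> M 1"
        using slack by (simp add: \<eta>_def)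
      also have "\<dots> \<le> surv \<epsilon> (j - 1) 1"
        using assms by (intro surv_antimono) auto
      also have "\<dots> \<le> surv \<epsilon> (j - 1) (int (j - i))"
        using assms by (intro surv_mono) auto
      finally have "\<eta> \<le> surv \<epsilon> (j - 1) (int (j - i))" .
      with up pi pi' show ?thesis
        unfolding pj using surv_nonneg[of "int (j - i)" "j - 1"] by linarith
    next
      case 3
      then have "pot \<eta> m n i = pot \<eta> m n j"
        using assms unfolding pot_def by simp
      then show ?thesis
        using surv_nonneg[of "int (j - i)" "j - 1"] by simp
    qed
  qed
  then show ?thesis
    by (simp add: \<eta>_def potential_def)
qed

end

section \<open>Averages and the nonexpansive map\<close>

text \<open>These are the iterates for the constant step \<open>1 - \<epsilon>\<close>, once
  \<open>w (Suc n)\<close> is the image of the n-th one.\<close>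

primrec average :: "real \<Rightarrow> (nat \<Rightarrow> 'a::real_vector) \<Rightarrow> nat \<Rightarrow> 'a" where
  "average \<epsilon> w 0 = w 0"
| "average \<epsilon> w (Suc n) = \<epsilon> *\<^sub>R average \<epsilon> w n + (1 - \<epsilon>) *\<^sub>R w (Suc n)"

text \<open>At \<open>n = 0\<close> truncated subtraction gives \<open>w 0\<close> twice, so the
  identity can be iterated without case distinctions.\<close>

lemma average_eq:
  "average \<epsilon> w n = (1 - \<epsilon>) *\<^sub>R w n + \<epsilon> *\<^sub>R average \<epsilon> w (n - 1)"
  by (cases n) (simp_all add: algebra_simps)

lemma average_le:
  fixes u :: "nat \<Rightarrow> real"
  assumes "0 \<le> \<epsilon>" "\<epsilon> \<le> 1" and "\<And>i j. i \<le> j \<Longrightarrow> j \<le> n \<Longrightarrow> u i \<le> u j"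
  shows "average \<epsilon> u n \<le> u n"
  using assms(3)
proof (induction n)
  case (Suc n)
  have "average \<epsilon> u n \<le> u (Suc n)"
    using Suc.prems by (intro order_trans[OF Suc.IH]) auto
  then have "\<epsilon> * average \<epsilon> u n \<le> \<epsilon> * u (Suc n)"
    using assms by (intro mult_left_mono) auto
  then show ?case
    by (simp add: algebra_simps)
qed simp

lemma average_mono:
  fixes u :: "nat \<Rightarrow> real"
  assumes "0 \<le> \<epsilon>" "\<epsilon> \<le> 1" and mono: "\<And>i j. i \<le> j \<Longrightarrow> j \<le> n \<Longrightarrow> u i \<le> u j" and "m \<le> n"
  shows "average \<epsilon> u m \<le> average \<epsilon> u n"
  using \<open>m \<le> n\<close> mono
proof (induction n rule: dec_induct)
  case (step n)
  have "average \<epsilon> u n \<le> u n"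
    using assms(1,2) step.prems by (intro average_le) auto
  also have "\<dots> \<le> u (Suc n)"
    using step.prems by simp
  finally have "(1 - \<epsilon>) * average \<epsilon> u n \<le> (1 - \<epsilon>) * u (Suc n)"
    using assms by (intro mult_left_mono) auto
  then show ?case
    using step.IH step.prems by (force simp: algebra_simps)
qed simp

text \<open>Testing the difference of the two averages against the potential bounds their distance
  from below. The last two points contribute \<open>g (n - m)\<close> and
  \<open>g (n - m - 1) - g (n - m) + g (n - m + 1)\<close>; with their weights these recombine to
  the recursion of \<open>surv\<close>.\<close>

lemma average_potential_diff:
  assumes eps: "0 < \<epsilon>" "\<epsilon> < 1" and "m < n"
  shows "surv \<epsilon> n (int (n - m)) \<le>
    average \<epsilon> (potential \<epsilon> M m n) n - average \<epsilon> (potential \<epsilon> M m n) m"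
proof -
  define g where "g = (\<lambda>k. surv \<epsilon> (n - 1) (int k))"
  interpret concave_profile g
    unfolding g_def using eps by (rule concave_profile_surv)
  define u where "u = pot (real M * \<epsilon>\<^sup>2) m n"
  have "average \<epsilon> u (m - 1 - 1) \<le> average \<epsilon> u (n - 1 - 1)"
    unfolding u_def using assms by (intro average_mono pot_mono) auto
  then have nn: "0 \<le> \<epsilon>\<^sup>2 * (average \<epsilon> u (n - 1 - 1) - average \<epsilon> u (m - 1 - 1))"
    by simp
  \<comment> \<open>Only the last two of the averaged points matter; the rest contributes a nonnegative amount.\<close>
  have av: "average \<epsilon> u k =
      (1 - \<epsilon>) * u k + \<epsilon> * (1 - \<epsilon>) * u (k - 1) + \<epsilon>\<^sup>2 * average \<epsilon> u (k - 1 - 1)" for k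
  proof -
    have "average \<epsilon> u k = (1 - \<epsilon>) * u k + \<epsilon> * average \<epsilon> u (k - 1)"
      using average_eq[of \<epsilon> u k] by simp
    also have "average \<epsilon> u (k - 1) = (1 - \<epsilon>) * u (k - 1) + \<epsilon> * average \<epsilon> u (k - 1 - 1)"
      using average_eq[of \<epsilon> u "k - 1"] by simp
    finally show ?thesis
      by (simp add: power2_eq_square algebra_simps)
  qed
  have 1: "(1 - \<epsilon>) * (u n - u m) + \<epsilon> * (1 - \<epsilon>) * (u (n - 1) - u (m - 1))
      \<le> average \<epsilon> u n - average \<epsilon> u m"
    using nn unfolding av[of n] av[of m] by (simp add: right_diff_distrib)
  have 2: "u n - u m = g (n - m)"
    using assms by (simp add: u_def pot_def zero)
  have 3: "u (n - 1) - u (m - 1) = g (n - m - 1) - g (n - m) + g (n - m + 1)"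
  proof (cases "m = 0")
    case True
    \<comment> \<open>For \<open>m = 0\<close> there is no point before \<open>m\<close>, but
      \<open>g\<close> is constant from \<open>n\<close> on, so the last two terms of the formula
      cancel.\<close>
    have "g n = (1 - \<epsilon>\<^sup>2) ^ (n - 1)" "g (Suc n) = (1 - \<epsilon>\<^sup>2) ^ (n - 1)"
      unfolding g_def using assms by (auto intro!: surv_far)
    moreover have "u (m - 1) = 0"
      using True assms by (simp add: u_def pot_0)
    moreover have "u (n - 1) = g (n - 1)"
      using True assms by (simp add: u_def pot_def)
    ultimately show ?thesis
      using True assms by simp
  next
    case False
    have "u (n - 1) = g (n - m - 1) + g n - g (n - m)"
    proof -
      have "\<not> n < n - 1" "\<not> n - 1 < m" "n - 1 - m = n - m - 1"
        using assms by auto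
      then show ?thesis
        by (simp only: u_def pot_def if_False)
    qed
    moreover have "u (m - 1) = g n - g (n - m + 1)"
    proof -
      have "\<not> n < m - 1" "m - 1 < m" "n - (m - 1) = n - m + 1"
        using assms False by auto
      then show ?thesis
        by (simp only: u_def pot_def if_False if_True)
    qed
    ultimately show ?thesis
      by simp
  qed
  have "surv \<epsilon> n (int (n - m)) =
      (1 - \<epsilon>)\<^sup>2 * g (n - m) + \<epsilon> * (1 - \<epsilon>) * (g (n - m + 1) + g (n - m - 1))"
    using assms surv_Suc[of \<epsilon> "n - 1" "int (n - m)"]
    by (simp add: g_def of_nat_diff add.commute diff_diff_eq)
  also have "\<dots> = (1 - \<epsilon>) * (u n - u m) + \<epsilon> * (1 - \<epsilon>) * (u (n - 1) - u (m - 1))"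
    unfolding 2 3 by (simp add: power2_eq_square) (simp add: algebra_simps)
  finally show ?thesis
    using 1 unfolding u_def g_def potential_def by simp
qed

section \<open>The nonexpansive map on the cube\<close>

lemma apply_Bcontfun:
  fixes f :: "nat \<Rightarrow> real"
  assumes "bounded (range f)"
  shows "apply_bcontfun (Bcontfun f) = f"
  using assms by (auto intro!: Bcontfun_inverse simp: bcontfun_def)

lemma apply_Bcontfun_unit:
  fixes f :: "nat \<Rightarrow> real"
  assumes "\<And>k. f k \<in> {0..1}"
  shows "apply_bcontfun (Bcontfun f) = f"
  using assms by (intro apply_Bcontfun boundedI[where B = 1]) (force simp: abs_le_iff)

text \<open>McShane's extension formula in every coordinate, cut off at 1. In the supremum norm,
  being 1-Lipschitz in each coordinate suffices.\<close>

lemma nonexpansive_extension_cube: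
  fixes p q :: "'i \<Rightarrow> linf"
  assumes "I \<noteq> {}" and cube: "\<And>i. i \<in> I \<Longrightarrow> q i \<in> unit_cube"
    and nonexp: "\<And>i j. i \<in> I \<Longrightarrow> j \<in> I \<Longrightarrow> norm (q i - q j) \<le> norm (p i - p j)"
  obtains T where "range T \<subseteq> unit_cube" "nonexpansive_on UNIV T" "\<And>i. i \<in> I \<Longrightarrow> T (p i) = q i"
proof
  define F where "F x k = (INF i\<in>I. q i k + norm (x - p i))" for x k
  define T where "T x = Bcontfun (\<lambda>k. min 1 (F x k))" for x
  have q01: "0 \<le> q i k" "q i k \<le> 1" if "i \<in> I" for i k
    using cube[OF that] by (auto simp: unit_cube_def)
  have bdd: "bdd_below ((\<lambda>i. q i k + norm (x - p i)) ` I)" for x k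
    using q01 by (intro bdd_belowI2[where m = 0]) auto
  have F_le: "F x k \<le> q i k + norm (x - p i)" if "i \<in> I" for i x k
    unfolding F_def by (rule cINF_lower[OF bdd that])
  have le_F: "c \<le> F x k" if "\<And>i. i \<in> I \<Longrightarrow> c \<le> q i k + norm (x - p i)" for c x k
    unfolding F_def using assms(1) that by (intro cINF_greatest) auto
  have T: "T x k = min 1 (F x k)" for x k
    unfolding T_def using le_F[of 0] q01 by (subst apply_Bcontfun_unit) auto
  show "range T \<subseteq> unit_cube"
    using le_F[of 0] q01 by (auto simp: unit_cube_def T)
  have F_lip: "F x k \<le> F y k + norm (x - y)" for x y k
  proof -
    have "F x k - norm (x - y) \<le> q i k + norm (y - p i)" if "i \<in> I" for i
      using F_le[OF that, of x k] norm_triangle_ineq[of "x - y" "y - p i"] by simp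
    then show ?thesis
      using le_F[of "F x k - norm (x - y)" k y] by simp
  qed
  have "norm (T x - T y) \<le> norm (x - y)" for x y
  proof (rule norm_bound)
    show "norm (apply_bcontfun (T x - T y) k) \<le> norm (x - y)" for k
      using F_lip[of x k y] F_lip[of y k x] by (auto simp: T norm_minus_commute)
  qed
  then show "nonexpansive_on UNIV T"
    by (simp add: nonexpansive_on_def)
  show "T (p i) = q i" if "i \<in> I" for i
  proof (rule bcontfun_eqI)
    fix k
    have "q i k \<le> q j k + norm (p i - p j)" if "j \<in> I" for j
      using norm_bounded[of "q i - q j" k] nonexp[OF \<open>i \<in> I\<close> that] by simp
    then have "q i k \<le> F (p i) k"
      by (rule le_F)
    then show "T (p i) k = q i k"
      using F_le[OF that, of "p i" k] q01[OF that] by (simp add: T)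
  qed
qed

lemma apply_average: "apply_bcontfun (average \<epsilon> w n) k = average \<epsilon> (\<lambda>i. apply_bcontfun (w i) k) n"
  for w :: "nat \<Rightarrow> linf"
  by (induction n) auto

lemma exists_map_residual_ge_surv:
  assumes eps: "0 < \<epsilon>" "\<epsilon> < 1" and slack: "real (n + 2) * \<epsilon>\<^sup>2 \<le> surv \<epsilon> (n + 2) 1"
  obtains T :: "linf \<Rightarrow> linf" and x0 :: linf
  where "T ` unit_cube \<subseteq> unit_cube" "nonexpansive_on unit_cube T" "x0 \<in> unit_cube"
    "surv \<epsilon> (n + 1) 1
      \<le> norm (km_iterate T (\<lambda>_. 1 - \<epsilon>) x0 n - T (km_iterate T (\<lambda>_. 1 - \<epsilon>) x0 n))"
proof -
  \<comment> \<open>Coordinate \<open>k\<close> encodes a pair \<open>(m, l)\<close>. The horizon is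
    \<open>n + 2\<close> because the images of \<open>x 0\<close> up to \<open>x (n + 1)\<close> are
    prescribed as \<open>w 1\<close> up to \<open>w (n + 2)\<close>.\<close>
  define W where "W i k = (case prod_decode k of (m, l) \<Rightarrow>
    if m < l then potential \<epsilon> (n + 2) m l i else 0)" for i k
  define w where "w i = Bcontfun (W i)" for i
  define x where "x = average \<epsilon> w"
  have W01: "W i k \<in> {0..1}" for i k
    using potential_range[OF eps] by (auto simp: W_def split: prod.split)
  have w: "apply_bcontfun (w i) = W i" for i
    unfolding w_def using W01 by (rule apply_Bcontfun_unit)
  have w_cube: "w i \<in> unit_cube" for i
    using W01 by (simp add: unit_cube_def w)
  have w_dist: "norm (w i - w j) \<le> surv \<epsilon> (j - 1) (int (j - i))" if "i < j" "j \<le> n + 2" for i j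
  proof (rule norm_bound)
    show "norm (apply_bcontfun (w i - w j) k) \<le> surv \<epsilon> (j - 1) (int (j - i))" for k
      using potential_lipschitz[OF eps _ that slack] surv_nonneg[OF eps]
      by (auto simp: w W_def split: prod.split)
  qed
  have x_dist: "surv \<epsilon> l (int (l - m)) \<le> norm (x l - x m)" if "m < l" for m l
  proof -
    define k where "k = prod_encode (m, l)"
    have "(\<lambda>i. w i k) = potential \<epsilon> (n + 2) m l"
      using that by (simp add: w W_def k_def)
    then have "surv \<epsilon> l (int (l - m)) \<le> x l k - x m k"
      using average_potential_diff[OF eps that, of "n + 2"] by (simp add: x_def apply_average)
    also have "\<dots> \<le> norm (x l - x m)"
      using norm_bounded[of "x l - x m" k] by simp
    finally show ?thesis .
  qed
  \<comment> \<open>The index shift makes the upper bound \<open>w_dist\<close> coincide with the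
    lower bound \<open>x_dist\<close>.\<close>
  have less: "norm (w (Suc i) - w (Suc j)) \<le> norm (x i - x j)" if "i < j" "j \<le> n + 1" for i j
    using w_dist[of "Suc i" "Suc j"] x_dist[of i j] that by (simp add: norm_minus_commute)
  have nonexp: "norm (w (Suc i) - w (Suc j)) \<le> norm (x i - x j)" if "i \<in> {..n + 1}" "j \<in> {..n + 1}" for i j
    using less[of i j] less[of j i] that
    by (cases i j rule: linorder_cases) (auto simp: norm_minus_commute)
  obtain T where T: "range T \<subseteq> unit_cube" "nonexpansive_on UNIV T"
    and Tx: "\<And>i. i \<in> {..n + 1} \<Longrightarrow> T (x i) = w (Suc i)"
    by (rule nonexpansive_extension_cube[of "{..n + 1}" "\<lambda>i. w (Suc i)" x]) (use w_cube nonexp in auto)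
  have km: "km_iterate T (\<lambda>_. 1 - \<epsilon>) (w 0) i = x i" if "i \<le> n + 1" for i
    using that by (induction i) (simp_all add: x_def Tx[unfolded x_def])
  have "surv \<epsilon> (n + 1) 1 \<le> norm (x (n + 1) - x n)"
    using x_dist[of n "n + 1"] by simp
  \<comment> \<open>A step of the iteration is the residual scaled by \<open>1 - \<epsilon>\<close>,
    so it bounds the residual from below.\<close>
  also have "x (n + 1) - x n = (1 - \<epsilon>) *\<^sub>R (T (x n) - x n)"
    using Tx[of n] by (simp add: x_def algebra_simps)
  also have "norm \<dots> \<le> norm (x n - T (x n))"
    using eps by (simp add: norm_minus_commute mult_left_le_one_le)
  finally have "surv \<epsilon> (n + 1) 1 \<le> norm (x n - T (x n))" .
  with T km[of n] w_cube[of 0] show ?thesis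
    by (intro that[of T "w 0"]) (auto simp: nonexpansive_on_def)
qed

lemma diameter_unit_cube: "diameter unit_cube = 1"
proof (rule antisym)
  have nb: "norm (x - y) \<le> 1" if "x \<in> unit_cube" "y \<in> unit_cube" for x y :: linf
  proof (rule norm_bound)
    show "norm (apply_bcontfun (x - y) k) \<le> 1" for k
      using that[unfolded unit_cube_def, simplified] by (smt (verit) minus_bcontfun.rep_eq real_norm_def)
  qed
  then show "diameter unit_cube \<le> 1"
    by (intro diameter_le) auto
  have mem: "const_bcontfun 0 \<in> unit_cube" "const_bcontfun 1 \<in> unit_cube"
    by (simp_all add: unit_cube_def const_bcontfun.rep_eq)
  have "bounded unit_cube"
    using nb mem(1) by (metis bounded_def dist_norm)
  then have "dist (const_bcontfun 1 :: linf) (const_bcontfun 0) \<le> diameter unit_cube"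
    using mem by (intro diameter_bounded_bound) auto
  moreover have "1 \<le> norm (const_bcontfun 1 - const_bcontfun 0 :: linf)"
    using norm_bounded[of "const_bcontfun 1 - const_bcontfun 0 :: linf" 0]
    by (simp add: const_bcontfun.rep_eq)
  ultimately show "1 \<le> diameter unit_cube"
    by (simp add: dist_norm)
qed

section \<open>Asymptotics of the survival probability\<close>

lemma step_funpow_linear:
  "(step c p ^^ t) (\<lambda>D. a * f D + b * h D) D = a * (step c p ^^ t) f D + b * (step c p ^^ t) h D"
proof (induction t arbitrary: D)
  case (Suc t)
  then show ?case by (simp add: step_def algebra_simps)
qed simp

text \<open>By reflection, for \<open>D > 0\<close> this is the probability that the simple
  symmetric walk from \<open>D\<close> avoids 0 for \<open>s\<close> steps.\<close>

definition srw :: "nat \<Rightarrow> int \<Rightarrow> real" where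
  "srw s = (step 0 (1 / 2) ^^ s) (\<lambda>D. of_int (sgn D))"

lemma srw_0: "srw 0 D = of_int (sgn D)"
  by (simp add: srw_def)

lemma srw_Suc: "srw (Suc s) D = (srw s (D + 1) + srw s (D - 1)) / 2"
  by (simp add: srw_def step_def)

text \<open>A lazy step either holds, keeping \<open>s\<close>, or makes one move of the simple
  walk, raising \<open>s\<close> by one.\<close>

lemma step_srw: "step c p (srw s) = (\<lambda>D. c * srw s D + 2 * p * srw (Suc s) D)"
  by (simp add: fun_eq_iff step_def srw_Suc)

lemma srw_minus: "srw s (- D) = - srw s D"
  unfolding srw_def by (rule step_funpow_odd) simp

text \<open>The increments of \<open>sgn\<close> are unit masses at -1 and 0. After \<open>s\<close>
  steps parity leaves only one of them within reach, with a binomial probability. Extending the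
  coefficients by 0 to negative \<open>k\<close> makes Pascal's rule hold for all integers.\<close>

lemma srw_increment:
  fixes k :: int
  defines "z \<equiv> \<lambda>s (k :: int). if k < 0 then 0 else real (s choose nat k)"
  shows "srw s (2 * k - int s + 1) - srw s (2 * k - int s) = z s k / 2 ^ s"
    and "srw s (2 * k - int s) - srw s (2 * k - 1 - int s) = z s k / 2 ^ s"
proof -
  have pascal: "z (Suc s) k = z s k + z s (k - 1)" for s k
  proof -
    consider "k < 0" | "k = 0" | "k > 0" by linarith
    then show ?thesis
    proof cases
      case 3
      then have "nat k = Suc (nat (k - 1))" by simp
      then show ?thesis
        using 3 by (simp add: z_def)
    qed (simp_all add: z_def)
  qed
  have "\<forall>k. srw s (2 * k - int s + 1) - srw s (2 * k - int s) = z s k / 2 ^ s \<and>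
      srw s (2 * k - int s) - srw s (2 * k - 1 - int s) = z s k / 2 ^ s" for s
  proof (induction s)
    case 0
    have "2 * k \<noteq> 1" for k :: int
      by presburger
    then show ?case
      by (auto simp: srw_0 z_def sgn_if)
  next
    case (Suc s)
    have 1: "srw s (2 * k - int s + 1) = srw s (2 * k - int s) + z s k / 2 ^ s"
      "srw s (2 * k - int s) = srw s (2 * k - 1 - int s) + z s k / 2 ^ s" for k
      using Suc by (metis add.commute diff_eq_eq)+
    have "2 * (k - 1) - int s + 1 = 2 * k - int s - 1" "2 * (k - 1) - int s = 2 * k - int s - 2"
      "2 * k - 1 - int s = 2 * k - int s - 1" "2 * (k - 1) - 1 - int s = 2 * k - int s - 3" for k
      by simp_all
    note 2 = 1[of k for k] 1[of "k - 1" for k, unfolded this]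
    show ?case
      using 2 by (simp add: srw_Suc pascal algebra_simps add_divide_distrib)
  qed
  then show "srw s (2 * k - int s + 1) - srw s (2 * k - int s) = z s k / 2 ^ s"
    and "srw s (2 * k - int s) - srw s (2 * k - 1 - int s) = z s k / 2 ^ s" by auto
qed

lemma srw_one_even: "srw (2 * n) 1 = real ((2 * n) choose n) / 4 ^ n"
  using srw_increment(1)[of "2 * n" "int n"] srw_minus[of "2 * n" 0]
  by (simp add: power_mult)

lemma central_binomial_Suc:
  "real (Suc n) * real ((2 * Suc n) choose Suc n) = 2 * (2 * real n + 1) * real ((2 * n) choose n)"
proof -
  have "(2 * Suc n) choose Suc n = 2 * (Suc (2 * n) choose n)"
    using binomial_symmetric[of n "Suc (2 * n)"] by (simp add: mult_2 Suc_diff_le)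
  moreover have "Suc n * (Suc (2 * n) choose n) = Suc (2 * n) * ((2 * n) choose n)"
    using Suc_times_binomial_eq[of "2 * n" n] binomial_symmetric[of n "Suc (2 * n)"]
    by (simp add: Suc_diff_le mult_2 mult.commute)
  then have "real (Suc n) * real (Suc (2 * n) choose n) = real (Suc (2 * n)) * real ((2 * n) choose n)"
    by (metis of_nat_mult)
  ultimately show ?thesis
    by (simp add: algebra_simps del: binomial_Suc_Suc)
qed

text \<open>From 1 the walk can be at 0 only at odd times, so this is also the value after
  \<open>2 * n + 2\<close> steps.\<close>

lemma srw_one_odd: "srw (Suc (2 * n)) 1 = real ((2 * Suc n) choose Suc n) / 4 ^ Suc n"
proof -
  have "(2 * Suc n) choose Suc n = 2 * (Suc (2 * n) choose Suc n)"
    using binomial_symmetric[of n "Suc (2 * n)"] by (simp add: mult_2 Suc_diff_le)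
  moreover have "srw (Suc (2 * n)) 1 = real (Suc (2 * n) choose Suc n) / 2 ^ Suc (2 * n)"
    using srw_increment(2)[of "Suc (2 * n)" "int (Suc n)"] srw_minus[of "Suc (2 * n)" 0]
    by (simp add: nat_add_distrib del: binomial_Suc_Suc)
  ultimately show ?thesis
    by (simp add: power_mult del: binomial_Suc_Suc)
qed

section \<open>Wallis' product and the survival of the simple walk\<close>

text \<open>From \<open>n\<close> to \<open>n + 1\<close> the normalised coefficient gains the
  factor \<open>(2 * n + 1) / (2 * n + 2)\<close>; its square times
  \<open>(2 * n + 3) / (2 * n + 1)\<close> is the reciprocal of the new Wallis factor.\<close>

lemma central_binomial_wallis:
  "(real ((2 * n) choose n) / 4 ^ n)\<^sup>2 * (2 * real n + 1) *
    (\<Prod>k=1..n. (4 * real k ^ 2) / (4 * real k ^ 2 - 1)) = 1"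
proof (induction n)
  case (Suc n)
  define c where "c = real ((2 * n) choose n) / 4 ^ n"
  define P where "P = (\<Prod>k=1..n. (4 * real k ^ 2) / (4 * real k ^ 2 - 1))"
  have c: "real ((2 * Suc n) choose Suc n) / 4 ^ Suc n = c * (2 * real n + 1) / (2 * real n + 2)"
  proof -
    have "C / (4 * p) = D / p * (2 * a + 1) / (2 * a + 2)"
      if "(a + 1) * C = 2 * (2 * a + 1) * D" "a \<ge> 0" "p > 0" for a C D p :: real
    proof -
      have "C = 2 * (2 * a + 1) * D / (a + 1)"
        using that by (simp add: eq_divide_eq mult.commute)
      moreover have "(a + 1) * (4 * p) \<noteq> 0" "p * (2 * a + 2) \<noteq> 0"
        using that by auto
      ultimately show ?thesis
        by (simp add: frac_eq_eq) (simp add: algebra_simps)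
    qed
    from this[of "real n" _ _ "4 ^ n"] central_binomial_Suc[of n] show ?thesis
      by (simp add: c_def add.commute del: binomial_Suc_Suc)
  qed
  have "4 * real (Suc n) ^ 2 - 1 = (2 * real n + 1) * (2 * real n + 3)"
    by (simp add: power2_eq_square algebra_simps)
  moreover have "4 * real (Suc n) ^ 2 = (2 * real n + 2)\<^sup>2"
    by (simp add: power2_eq_square algebra_simps)
  ultimately have P: "(\<Prod>k=1..Suc n. (4 * real k ^ 2) / (4 * real k ^ 2 - 1))
      = P * ((2 * real n + 2)\<^sup>2 / ((2 * real n + 1) * (2 * real n + 3)))"
    by (simp add: P_def del: of_nat_Suc)
  have "2 * real (Suc n) + 1 = 2 * real n + 3"
    by simp
  then have "(real ((2 * Suc n) choose Suc n) / 4 ^ Suc n)\<^sup>2 * (2 * real (Suc n) + 1) *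
      (\<Prod>k=1..Suc n. (4 * real k ^ 2) / (4 * real k ^ 2 - 1)) =
      (c * (2 * real n + 1) / (2 * real n + 2))\<^sup>2 * (2 * real n + 3) *
      (P * ((2 * real n + 2)\<^sup>2 / ((2 * real n + 1) * (2 * real n + 3))))"
    by (simp only: c P)
  also have "\<dots> = c\<^sup>2 * (2 * real n + 1) * P"
  proof -
    have cancel: "(c * a / b)\<^sup>2 * d * (P * (b\<^sup>2 / (a * d))) = c\<^sup>2 * a * P" if "a > 0" "b > 0" "d > 0" for a b d :: real
      using that by (simp add: power2_eq_square field_simps)
    show ?thesis
      by (rule cancel) auto
  qed
  also have "\<dots> = 1"
    using Suc by (simp add: c_def P_def)
  finally show ?case .
qed simp

text \<open>The Wallis products increase to \<open>pi / 2\<close>, so each of them is at most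
  \<open>pi / 2\<close>; this gives a bound for every \<open>n\<close>, not just an asymptotic
  one.\<close>

lemma central_binomial_ge: "sqrt (2 / (pi * (2 * real n + 1))) \<le> real ((2 * n) choose n) / 4 ^ n"
proof -
  define P where "P n = (\<Prod>k=1..n. (4 * real k ^ 2) / (4 * real k ^ 2 - 1))" for n
  define c where "c = real ((2 * n) choose n) / 4 ^ n"
  have ge1: "1 \<le> (4 * real k ^ 2) / (4 * real k ^ 2 - 1)" if "k \<ge> 1" for k
  proof -
    have "1 \<le> real k ^ 2"
      using that by simp
    then show ?thesis by (simp add: field_simps)
  qed
  have pos: "1 \<le> P n" for n
    unfolding P_def using ge1 by (intro prod_ge_1) auto
  have "incseq P"
  proof (rule incseq_SucI)
    show "P n \<le> P (Suc n)" for n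
      using mult_left_mono[OF ge1[of "Suc n"], of "P n"] pos[of n] by (simp add: P_def)
  qed
  moreover have "P \<longlonglongrightarrow> pi / 2"
    unfolding P_def by (rule wallis)
  ultimately have "P n \<le> pi / 2"
    by (rule incseq_le)
  then have "c\<^sup>2 * (2 * real n + 1) * P n \<le> c\<^sup>2 * (2 * real n + 1) * (pi / 2)"
    by (intro mult_left_mono) auto
  moreover have "c\<^sup>2 * (2 * real n + 1) * P n = 1"
    unfolding c_def P_def by (rule central_binomial_wallis)
  ultimately have "1 \<le> c\<^sup>2 * (2 * real n + 1) * (pi / 2)"
    by (simp only:)
  moreover have "2 / (pi * a) \<le> c\<^sup>2" if "1 \<le> c\<^sup>2 * a * (pi / 2)" "a > 0" for a
    using that by (simp add: field_simps)
  ultimately have "2 / (pi * (2 * real n + 1)) \<le> c\<^sup>2"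
    by simp
  then have "sqrt (2 / (pi * (2 * real n + 1))) \<le> sqrt (c\<^sup>2)"
    by (rule real_sqrt_le_mono)
  then show ?thesis
    by (simp add: c_def)
qed

text \<open>The central binomial bound gives \<open>s + 1\<close> under the root for even
  \<open>s\<close> and \<open>s + 2\<close> for odd \<open>s\<close>; the weaker form serves both
  parities.\<close>

lemma srw_one_ge: "sqrt (2 / (pi * (real s + 2))) \<le> srw s 1"
proof (cases "even s")
  case True
  then obtain n where s: "s = 2 * n" by (elim evenE)
  have "sqrt (2 / (pi * (real s + 2))) \<le> sqrt (2 / (pi * (2 * real n + 1)))"
    unfolding s by (intro real_sqrt_le_mono divide_left_mono mult_left_mono mult_pos_pos) auto
  from order_trans[OF this central_binomial_ge] show ?thesis
    by (simp only: s srw_one_even)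
next
  case False
  then obtain n where s: "s = Suc (2 * n)" by (metis oddE Suc_eq_plus1)
  have "real s + 2 = 2 * real (Suc n) + 1"
    by (simp add: s)
  then show ?thesis
    using central_binomial_ge[of "Suc n"] by (simp only: s srw_one_odd)
qed

section \<open>From the simple walk to the killed lazy walk\<close>

lemma convex_on_inverse_sqrt_shift:
  "convex_on {0..} (\<lambda>x. sqrt (2 / (pi * (x + 2))))"
proof -
  define c where "c = sqrt (2 / pi)"
  have conv: "convex_on {0..} (\<lambda>x. c * (x + 2) powr (- (1/2)))"
  proof (rule f''_ge0_imp_convex)
    show "((\<lambda>x. c * (x + 2) powr (- (1/2))) has_real_derivative
        c * (- (1/2) * (x + 2) powr (- (3/2)))) (at x)" if "x \<in> {0..}" for x
      using that by (auto intro!: derivative_eq_intros simp: algebra_simps)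
    show "((\<lambda>x. c * (- (1/2) * (x + 2) powr (- (3/2)))) has_real_derivative
        c * (3/4 * (x + 2) powr (- (5/2)))) (at x)" if "x \<in> {0..}" for x
      using that by (auto intro!: derivative_eq_intros simp: algebra_simps)
    show "0 \<le> c * (3/4 * (x + 2) powr (- (5/2)))" for x
      by (simp add: c_def)
  qed simp
  have eq: "sqrt (2 / (pi * (x + 2))) = c * (x + 2) powr (- (1/2))" if "x \<in> {0..}" for x
  proof -
    have "(x + 2) powr (- (1/2)) = 1 / sqrt (x + 2)"
      using that by (simp only: powr_minus_divide powr_half_sqrt atLeast_iff)
    moreover have "sqrt (2 / (pi * (x + 2))) = c / sqrt (x + 2)"
      unfolding c_def by (simp only: real_sqrt_divide[symmetric] divide_divide_eq_left)
    ultimately show ?thesis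
      by (simp only: times_divide_eq_right mult_1_right)
  qed
  show ?thesis
  proof (rule convex_onI)
    fix t x y :: real
    assume t: "0 < t" "t < 1" and xy: "x \<in> {0..}" "y \<in> {0..}"
    have "0 \<le> (1 - t) * x + t * y"
      using t xy by (intro add_nonneg_nonneg mult_nonneg_nonneg) auto
    then have "(1 - t) *\<^sub>R x + t *\<^sub>R y \<in> {0..}"
      by (simp only: real_scaleR_def atLeast_iff)
    then show "sqrt (2 / (pi * ((1 - t) *\<^sub>R x + t *\<^sub>R y + 2)))
        \<le> (1 - t) * sqrt (2 / (pi * (x + 2))) + t * sqrt (2 / (pi * (y + 2)))"
      using convex_onD[OF conv, of t x y] t xy by (simp only: eq less_imp_le)
  qed simp
qed

text \<open>
  The killed lazy walk makes a binomially distributed number of moves of the simple walk; convexity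
  of the lower bound allows replacing that number by its mean (Jensen's inequality).
\<close>

lemma step_srw_one_ge:
  assumes eps: "0 < \<epsilon>" "\<epsilon> < 1"
  defines "q \<equiv> 2 * \<epsilon> / (1 + \<epsilon>)" and "\<phi> \<equiv> \<lambda>x. sqrt (2 / (pi * (x + 2)))"
  shows "(1 - \<epsilon>\<^sup>2) ^ t * \<phi> (real s + q * real t)
    \<le> (step ((1 - \<epsilon>)\<^sup>2) (\<epsilon> * (1 - \<epsilon>)) ^^ t) (srw s) 1"
proof (induction t arbitrary: s)
  case 0
  then show ?case
    using srw_one_ge[of s] by (simp add: \<phi>_def)
next
  case (Suc t)
  let ?A = "step ((1 - \<epsilon>)\<^sup>2) (\<epsilon> * (1 - \<epsilon>)) ^^ t"
  have q: "0 \<le> q" "q \<le> 1"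
    using eps by (auto simp: q_def)
  \<comment> \<open>The step splits into surviving, with probability
    \<open>1 - \<epsilon>\<^sup>2\<close>, and then moving with conditional probability
    \<open>q\<close>.\<close>
  have kernel: "(1 - \<epsilon>)\<^sup>2 = (1 - \<epsilon>\<^sup>2) * (1 - q)" "2 * (\<epsilon> * (1 - \<epsilon>)) = (1 - \<epsilon>\<^sup>2) * q"
    using eps by (simp_all add: q_def field_simps power2_eq_square)
  have r: "0 \<le> 1 - \<epsilon>\<^sup>2"
    using eps by (simp add: power_le_one)
  have "\<phi> ((1 - q) *\<^sub>R (real s + q * real t) + q *\<^sub>R (real (Suc s) + q * real t))
      \<le> (1 - q) * \<phi> (real s + q * real t) + q * \<phi> (real (Suc s) + q * real t)"
    unfolding \<phi>_def using q by (intro convex_onD[OF convex_on_inverse_sqrt_shift]) auto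
  also have "(1 - q) *\<^sub>R (real s + q * real t) + q *\<^sub>R (real (Suc s) + q * real t)
      = real s + q * real (Suc t)"
    by (simp add: algebra_simps)
  finally have "(1 - \<epsilon>\<^sup>2) ^ Suc t * \<phi> (real s + q * real (Suc t))
      \<le> (1 - \<epsilon>\<^sup>2) ^ Suc t * ((1 - q) * \<phi> (real s + q * real t) + q * \<phi> (real (Suc s) + q * real t))"
    using r by (intro mult_left_mono) auto
  also have "\<dots> = (1 - \<epsilon>)\<^sup>2 * ((1 - \<epsilon>\<^sup>2) ^ t * \<phi> (real s + q * real t))
      + 2 * (\<epsilon> * (1 - \<epsilon>)) * ((1 - \<epsilon>\<^sup>2) ^ t * \<phi> (real (Suc s) + q * real t))"
    unfolding kernel by (simp add: algebra_simps)
  also have "\<dots> \<le> (1 - \<epsilon>)\<^sup>2 * ?A (srw s) 1 + 2 * (\<epsilon> * (1 - \<epsilon>)) * ?A (srw (Suc s)) 1"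
    using eps by (intro add_mono mult_left_mono Suc.IH) auto
  also have "\<dots> = ?A (step ((1 - \<epsilon>)\<^sup>2) (\<epsilon> * (1 - \<epsilon>)) (srw s)) 1"
    by (simp only: step_srw step_funpow_linear)
  finally show ?case
    by (simp only: funpow_Suc_right comp_apply)
qed

text \<open>Bernoulli's inequality bounds the killing, and the mean number of moves,
  \<open>2 * \<epsilon> / (1 + \<epsilon>) * t\<close>, is at most
  \<open>2 * \<epsilon> * t\<close>.\<close>

lemma surv_one_ge:
  assumes eps: "0 < \<epsilon>" "\<epsilon> < 1" and "real t * \<epsilon>\<^sup>2 \<le> 1"
  shows "(1 - real t * \<epsilon>\<^sup>2) / sqrt (pi * (\<epsilon> * real t + 1)) \<le> surv \<epsilon> t 1"
proof -
  let ?\<phi> = "\<lambda>x. sqrt (2 / (pi * (x + 2)))"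
  have "1 + real t * (- \<epsilon>\<^sup>2) \<le> (1 + - \<epsilon>\<^sup>2) ^ t"
    using eps by (intro Bernoulli_inequality) (auto simp: power_le_one)
  moreover have "1 / sqrt (pi * (\<epsilon> * real t + 1)) = ?\<phi> (2 * \<epsilon> * real t)"
  proof -
    have "2 / (pi * (2 * \<epsilon> * real t + 2)) = (2 * 1) / (2 * (pi * (\<epsilon> * real t + 1)))"
      by (simp add: algebra_simps)
    then show ?thesis
      by (simp add: real_sqrt_divide)
  qed
  moreover have "?\<phi> (2 * \<epsilon> * real t) \<le> ?\<phi> (2 * \<epsilon> / (1 + \<epsilon>) * real t)"
    using eps by (intro real_sqrt_le_mono divide_left_mono mult_left_mono add_mono mult_right_mono
        mult_pos_pos) (auto simp: field_simps intro!: add_pos_nonneg)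
  ultimately have "(1 - real t * \<epsilon>\<^sup>2) * (1 / sqrt (pi * (\<epsilon> * real t + 1)))
      \<le> (1 - \<epsilon>\<^sup>2) ^ t * ?\<phi> (real 0 + 2 * \<epsilon> / (1 + \<epsilon>) * real t)"
    using eps assms(3) by (intro mult_mono) (auto simp: power_le_one)
  also have "\<dots> \<le> (step ((1 - \<epsilon>)\<^sup>2) (\<epsilon> * (1 - \<epsilon>)) ^^ t) (srw 0) 1"
    by (rule step_srw_one_ge[OF eps])
  also have "\<dots> = surv \<epsilon> t 1"
    by (simp add: surv_def srw_def)
  finally show ?thesis
    by simp
qed

section \<open>Choice of the parameters and conclusion\<close>

lemma exists_parameters:
  fixes \<kappa> :: real
  assumes "\<kappa> < 1 / sqrt pi"
  obtains \<epsilon> :: real and n :: nat where "0 < \<epsilon>" "\<epsilon> < 1" "n \<ge> 1"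
    "real (n + 2) * \<epsilon>\<^sup>2 \<le> surv \<epsilon> (n + 2) 1"
    "\<kappa> / sqrt (real n * (\<epsilon> * (1 - \<epsilon>))) < surv \<epsilon> (n + 1) 1"
proof -
  \<comment> \<open>With \<open>\<epsilon> = 1 / k^2\<close> and \<open>n = k^3\<close>,
    \<open>\<epsilon> * n = k\<close> tends to infinity, while
    \<open>\<epsilon>\<^sup>2 * n = 1 / k\<close> vanishes faster than the survival probability,
    which is of order \<open>1 / sqrt k\<close>.\<close>
  define e where "e k = 1 / real k ^ 2" for k
  define N where "N k = real k ^ 3" for k
  have 1: "\<forall>\<^sub>F k in at_top. (N k + 2) * (e k)\<^sup>2 \<le>
      (1 - (N k + 2) * (e k)\<^sup>2) / sqrt (pi * (e k * (N k + 2) + 1))"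
    unfolding e_def N_def by real_asymp
  have "((\<lambda>k. (1 - (N k + 1) * (e k)\<^sup>2) / sqrt (pi * (e k * (N k + 1) + 1))
      * sqrt (N k * (e k * (1 - e k)))) \<longlongrightarrow> inverse (pi powr (1 / 2))) at_top"
    unfolding e_def N_def by real_asymp
  moreover have "inverse (pi powr (1 / 2)) = 1 / sqrt pi"
    by (simp add: powr_half_sqrt inverse_eq_divide)
  ultimately have "((\<lambda>k. (1 - (N k + 1) * (e k)\<^sup>2) / sqrt (pi * (e k * (N k + 1) + 1))
      * sqrt (N k * (e k * (1 - e k)))) \<longlongrightarrow> 1 / sqrt pi) at_top"
    by simp
  from order_tendstoD(1)[OF this assms]
  have 2: "\<forall>\<^sub>F k in at_top. \<kappa> < (1 - (N k + 1) * (e k)\<^sup>2) / sqrt (pi * (e k * (N k + 1) + 1))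
      * sqrt (N k * (e k * (1 - e k)))" .
  have 3: "\<forall>\<^sub>F k in at_top. (N k + 2) * (e k)\<^sup>2 \<le> 1" "\<forall>\<^sub>F k in at_top. e k < 1"
    unfolding e_def N_def by real_asymp+
  obtain k where k: "k \<ge> 1"
    and k1: "(N k + 2) * (e k)\<^sup>2 \<le> (1 - (N k + 2) * (e k)\<^sup>2) / sqrt (pi * (e k * (N k + 2) + 1))"
    and k2: "\<kappa> < (1 - (N k + 1) * (e k)\<^sup>2) / sqrt (pi * (e k * (N k + 1) + 1))
      * sqrt (N k * (e k * (1 - e k)))"
    and k3: "(N k + 2) * (e k)\<^sup>2 \<le> 1" "e k < 1"
    using eventually_happens[OF eventually_conj[OF eventually_ge_at_top[of 1]
          eventually_conj[OF 1 eventually_conj[OF 2 eventually_conj[OF 3]]]]] by auto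
  define n where "n = k ^ 3"
  have N: "real (n + 2) = N k + 2" "real (n + 1) = N k + 1" "real n = N k"
    by (simp_all add: n_def N_def)
  have e: "0 < e k"
    using k by (simp add: e_def)
  have n: "n \<ge> 1"
    using k by (simp add: n_def)
  have "(N k + 1) * (e k)\<^sup>2 \<le> (N k + 2) * (e k)\<^sup>2"
    by (intro mult_right_mono) auto
  then have k3': "(N k + 1) * (e k)\<^sup>2 \<le> 1"
    using k3 by linarith
  have pos: "0 < sqrt (N k * (e k * (1 - e k)))"
    using n e k3 by (simp flip: N)
  show ?thesis
  proof (rule that[of "e k" n])
    show "real (n + 2) * (e k)\<^sup>2 \<le> surv (e k) (n + 2) 1"
      using surv_one_ge[of "e k" "n + 2"] k1 k3 e unfolding N by linarith
    have "\<kappa> / sqrt (N k * (e k * (1 - e k))) <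
        (1 - (N k + 1) * (e k)\<^sup>2) / sqrt (pi * (e k * (N k + 1) + 1))"
      using k2 pos by (simp add: pos_divide_less_eq)
    then show "\<kappa> / sqrt (real n * (e k * (1 - e k))) < surv (e k) (n + 1) 1"
      using surv_one_ge[of "e k" "n + 1"] k3' k3 e unfolding N by linarith
  qed (use e k3 n in auto)
qed

theorem theorem1p1:
  fixes \<kappa> :: real
  assumes "\<kappa> < 1 / sqrt pi"
  shows "\<exists>(T :: linf \<Rightarrow> linf) (x0 :: linf) (\<alpha> :: nat \<Rightarrow> real).
           T ` unit_cube \<subseteq> unit_cube \<and> nonexpansive_on unit_cube T \<and> x0 \<in> unit_cube \<and>
           (\<exists>a. 0 < a \<and> a < 1 \<and> (\<forall>n. \<alpha> n = a)) \<and>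
           (\<exists>n\<ge>1. norm (km_iterate T \<alpha> x0 n - T (km_iterate T \<alpha> x0 n))
                  > \<kappa> * (diameter unit_cube / sqrt (\<Sum>i=1..n. \<alpha> i * (1 - \<alpha> i))))"
proof -
  obtain \<epsilon> :: real and n :: nat where eps: "0 < \<epsilon>" "\<epsilon> < 1" and n: "n \<ge> 1"
    and slack: "real (n + 2) * \<epsilon>\<^sup>2 \<le> surv \<epsilon> (n + 2) 1"
    and big: "\<kappa> / sqrt (real n * (\<epsilon> * (1 - \<epsilon>))) < surv \<epsilon> (n + 1) 1"
    using exists_parameters[OF assms] by blast
  obtain T :: "linf \<Rightarrow> linf" and x0 :: linf
    where T: "T ` unit_cube \<subseteq> unit_cube" "nonexpansive_on unit_cube T" "x0 \<in> unit_cube"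
    and res: "surv \<epsilon> (n + 1) 1
      \<le> norm (km_iterate T (\<lambda>_. 1 - \<epsilon>) x0 n - T (km_iterate T (\<lambda>_. 1 - \<epsilon>) x0 n))"
    using exists_map_residual_ge_surv[OF eps slack] by blast
  have "\<kappa> * (diameter unit_cube / sqrt (\<Sum>i=1..n. (1 - \<epsilon>) * (1 - (1 - \<epsilon>))))
      = \<kappa> / sqrt (real n * (\<epsilon> * (1 - \<epsilon>)))"
    by (simp add: diameter_unit_cube mult.commute)
  with big res have "\<kappa> * (diameter unit_cube / sqrt (\<Sum>i=1..n. (1 - \<epsilon>) * (1 - (1 - \<epsilon>))))
      < norm (km_iterate T (\<lambda>_. 1 - \<epsilon>) x0 n - T (km_iterate T (\<lambda>_. 1 - \<epsilon>) x0 n))"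
    by linarith
  then show ?thesis
    using T n eps
    by (intro exI[of _ T] exI[of _ x0] exI[of _ "\<lambda>_. 1 - \<epsilon>"] conjI exI[of _ "1 - \<epsilon>"] exI[of _ n]) auto
qed

end
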